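(* Let $K$ be an arbitrary wedge in $L^0$, and let $\emptyset\neq M$ be a face of $M_1=M_1(\mathbb P;K)$. Then $R(M)^\lhd=c_E(K)$.
   Context: $(\Omega,\mathcal F,\mathbb P)$ is a probability space and $L^0=L^0(\Omega,\mathcal F,\mathbb P)$ is the vector lattice of real random variables modulo $\mathbb P$-a.s. equality, ordered $\mathbb P$-a.s. For a probability measure $\mathbb Q\ll\mathbb P$, $L^1(\mathbb Q)$ is regarded as the set of $X\in L^0$ with $\mathbb E_{\mathbb Q}|X|<\infty$. A wedge in a real vector space is a non-empty convex set $C$ with $\lambda C\subseteq C$ for all $\lambda\ge0$. $[S]$ is the linear span of $S$. A convex subset $G$ of a convex set $C$ is a face of $C$ if $\alpha x+(1-\alpha)y\in G$ with $x,y\in C$ and $0<\alpha<1$ implies $x,y\in G$. $M_1=M_1(\mathbb P;K)$ is the set of all probability measures $\mathbb Q\ll\mathbb P$ such that $K\subseteq L^1(\mathbb Q)$ and $\mathbb E_{\mathbb Q}[X]\le0$ for all $X\in K$. $R(\mathbb Q):=\frac{d\mathbb Q}{d\mathbb P}\in L^1(\mathbb P)$. $E:=\bigcap_{\mathbb Q\in M}L^1(\mathbb Q)$ (a vector sublattice of $L^0$ containing $K$) and $F:=[R(M)]\subseteq L^1(\mathbb P)$, with bilinear form $\langle z,w\rangle:=\mathbb E_{\mathbb P}[zw]$ on $E\times F$ and associated weak topology $\sigma(E,F)$ (not necessarily Hausdorff). For non-empty $B\subseteq F$, $B^\lhd=\{z\in E:\langle z,w\rangle\le0\ \forall w\in B\}$.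 $s_E(K):=K-E_+=\{x\in E:x\le g\text{ for some }g\in K\}$ with $E_+=\{x\in E:x\ge0\}$, and $c_E(K):=\overline{s_E(K)}^{\sigma(E,F)}$. *)

theory Defs
  imports "HOL-Probability.Probability"
begin

text \<open>
  The vector lattice \<open>L\<^sup>0(P)\<close> of random variables modulo \<open>P\<close>-a.s. equality is represented by
  real-valued measurable functions. A subset of \<open>L\<^sup>0(P)\<close> is the set of all representatives of
  its elements, i.e. a set of measurable functions that is closed under \<open>P\<close>-a.s. equality;
  inequalities are always understood \<open>P\<close>-a.s.
\<close>

definition L0 :: "'a measure \<Rightarrow> ('a \<Rightarrow> real) set" where
  "L0 P = borel_measurable P"

definition L0_subset :: "'a measure \<Rightarrow> ('a \<Rightarrow> real) set \<Rightarrow> bool" where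
  "L0_subset P S \<longleftrightarrow> S \<subseteq> L0 P \<and> (\<forall>X\<in>S. \<forall>Y\<in>L0 P. (AE \<omega> in P. X \<omega> = Y \<omega>) \<longrightarrow> Y \<in> S)"

definition wedge_L0 :: "'a measure \<Rightarrow> ('a \<Rightarrow> real) set \<Rightarrow> bool" where
  "wedge_L0 P C \<longleftrightarrow>
     L0_subset P C \<and> C \<noteq> {} \<and>
     (\<forall>X\<in>C. \<forall>Y\<in>C. \<forall>\<alpha>. 0 \<le> \<alpha> \<and> \<alpha> \<le> 1 \<longrightarrow> (\<lambda>\<omega>. \<alpha> * X \<omega> + (1 - \<alpha>) * Y \<omega>) \<in> C) \<and>
     (\<forall>X\<in>C. \<forall>c\<ge>0. (\<lambda>\<omega>. c * X \<omega>) \<in> C)"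

definition span_L0 :: "'a measure \<Rightarrow> ('a \<Rightarrow> real) set \<Rightarrow> ('a \<Rightarrow> real) set" where
  "span_L0 P S = {w \<in> L0 P. \<exists>T c. finite T \<and> T \<subseteq> S \<and> (AE \<omega> in P. w \<omega> = (\<Sum>f\<in>T. c f * f \<omega>))}"

text \<open>Probability measures on the \<open>\<sigma>\<close>-algebra of \<open>P\<close> that are absolutely continuous w.r.t. \<open>P\<close>.\<close>

definition ac_probs :: "'a measure \<Rightarrow> 'a measure set" where
  "ac_probs P = {Q. prob_space Q \<and> sets Q = sets P \<and> absolutely_continuous P Q}"

definition L1 :: "'a measure \<Rightarrow> 'a measure \<Rightarrow> ('a \<Rightarrow> real) set" where
  "L1 P Q = {X \<in> L0 P. integrable Q X}"

definition M1 :: "'a measure \<Rightarrow> ('a \<Rightarrow> real) set \<Rightarrow> 'a measure set" where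
  "M1 P K = {Q \<in> ac_probs P. K \<subseteq> L1 P Q \<and> (\<forall>X\<in>K. integral\<^sup>L Q X \<le> 0)}"

text \<open>The convex combination \<open>\<alpha> Q\<^sub>1 + (1 - \<alpha>) Q\<^sub>2\<close> of two measures on the same \<open>\<sigma>\<close>-algebra.\<close>

definition mix_measure :: "real \<Rightarrow> 'a measure \<Rightarrow> 'a measure \<Rightarrow> 'a measure" where
  "mix_measure \<alpha> Q1 Q2 = measure_of (space Q1) (sets Q1)
     (\<lambda>A. ennreal \<alpha> * emeasure Q1 A + ennreal (1 - \<alpha>) * emeasure Q2 A)"

lemma sets_mix_measure: "sets (mix_measure \<alpha> Q1 Q2) = sets Q1"
  unfolding mix_measure_def by simp

lemma emeasure_mix_measure:
  assumes "sets Q1 = sets Q2" "A \<in> sets Q1"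
  shows "emeasure (mix_measure \<alpha> Q1 Q2) A =
    ennreal \<alpha> * emeasure Q1 A + ennreal (1 - \<alpha>) * emeasure Q2 A"
proof (rule emeasure_measure_of[OF mix_measure_def])
  show "sets Q1 \<subseteq> Pow (space Q1)" by (rule sets.space_closed)
  show "A \<in> sets (mix_measure \<alpha> Q1 Q2)" using assms by (simp add: sets_mix_measure)
  show "positive (sets (mix_measure \<alpha> Q1 Q2))
     (\<lambda>A. ennreal \<alpha> * emeasure Q1 A + ennreal (1 - \<alpha>) * emeasure Q2 A)"
    by (simp add: positive_def)
  show "countably_additive (sets (mix_measure \<alpha> Q1 Q2))
     (\<lambda>A. ennreal \<alpha> * emeasure Q1 A + ennreal (1 - \<alpha>) * emeasure Q2 A)"
    unfolding sets_mix_measure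
  proof (rule countably_additiveI)
    fix B :: "nat \<Rightarrow> 'a set"
    assume B: "range B \<subseteq> sets Q1" "disjoint_family B" "\<Union> (range B) \<in> sets Q1"
    then have "(\<Sum>i. emeasure Q1 (B i)) = emeasure Q1 (\<Union> (range B))"
      "(\<Sum>i. emeasure Q2 (B i)) = emeasure Q2 (\<Union> (range B))"
      using assms(1) by (auto intro!: suminf_emeasure)
    then show "(\<Sum>i. ennreal \<alpha> * emeasure Q1 (B i) + ennreal (1 - \<alpha>) * emeasure Q2 (B i)) =
      ennreal \<alpha> * emeasure Q1 (\<Union> (range B)) + ennreal (1 - \<alpha>) * emeasure Q2 (\<Union> (range B))"
      by (simp add: suminf_add[symmetric] ennreal_suminf_cmult)
  qed
qed

text \<open>
  The library's \<open>face_of\<close> is for subsets of a real vector space type and does not apply to sets of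
  measures. Faces are only taken of \<open>M1 P K\<close>, which is always convex.
\<close>

definition face_of_measures :: "'a measure set \<Rightarrow> 'a measure set \<Rightarrow> bool" where
  "face_of_measures G C \<longleftrightarrow>
     G \<subseteq> C \<and>
     (\<forall>Q1\<in>G. \<forall>Q2\<in>G. \<forall>\<alpha>. 0 \<le> \<alpha> \<and> \<alpha> \<le> 1 \<longrightarrow> mix_measure \<alpha> Q1 Q2 \<in> G) \<and>
     (\<forall>Q1\<in>C. \<forall>Q2\<in>C. \<forall>\<alpha>. 0 < \<alpha> \<and> \<alpha> < 1 \<and> mix_measure \<alpha> Q1 Q2 \<in> G \<longrightarrow> Q1 \<in> G \<and> Q2 \<in> G)"

text \<open>A real-valued version of the density \<open>dQ/dP\<close>; \<open>RN_deriv\<close> itself takes values in \<open>ennreal\<close>.\<close>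

definition R :: "'a measure \<Rightarrow> 'a measure \<Rightarrow> 'a \<Rightarrow> real" where
  "R P Q = (\<lambda>\<omega>. enn2real (RN_deriv P Q \<omega>))"

definition E_space :: "'a measure \<Rightarrow> 'a measure set \<Rightarrow> ('a \<Rightarrow> real) set" where
  "E_space P M = (\<Inter>Q\<in>M. L1 P Q)"

definition F_space :: "'a measure \<Rightarrow> 'a measure set \<Rightarrow> ('a \<Rightarrow> real) set" where
  "F_space P M = span_L0 P (R P ` M)"

definition bform :: "'a measure \<Rightarrow> ('a \<Rightarrow> real) \<Rightarrow> ('a \<Rightarrow> real) \<Rightarrow> real" where
  "bform P z w = (\<integral>\<omega>. z \<omega> * w \<omega> \<partial>P)"

text \<open>The weak topology \<open>\<sigma>(E,F)\<close>: the coarsest topology on \<open>E\<close> making all \<open>\<langle>\<cdot>,w\<rangle>\<close>, \<open>w \<in> F\<close>, continuous.\<close>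

definition weak_topology ::
  "'a measure \<Rightarrow> ('a \<Rightarrow> real) set \<Rightarrow> ('a \<Rightarrow> real) set \<Rightarrow> ('a \<Rightarrow> real) topology" where
  "weak_topology P E F =
     topology_generated_by {{z \<in> E. bform P z w \<in> U} | w U. w \<in> F \<and> open U}"

lemma topspace_weak_topology: "F \<noteq> {} \<Longrightarrow> topspace (weak_topology P E F) = E"
  unfolding weak_topology_def topology_generated_by_topspace by auto

definition polar :: "'a measure \<Rightarrow> ('a \<Rightarrow> real) set \<Rightarrow> ('a \<Rightarrow> real) set \<Rightarrow> ('a \<Rightarrow> real) set" where
  "polar P E B = {z \<in> E. \<forall>w\<in>B. bform P z w \<le> 0}"

definition nonneg_part :: "'a measure \<Rightarrow> ('a \<Rightarrow> real) set \<Rightarrow> ('a \<Rightarrow> real) set" where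
  "nonneg_part P E = {x \<in> E. AE \<omega> in P. 0 \<le> x \<omega>}"

definition s_hull ::
  "'a measure \<Rightarrow> ('a \<Rightarrow> real) set \<Rightarrow> ('a \<Rightarrow> real) set \<Rightarrow> ('a \<Rightarrow> real) set" where
  "s_hull P E K = {(\<lambda>\<omega>. g \<omega> - y \<omega>) | g y. g \<in> K \<and> y \<in> nonneg_part P E}"

definition c_hull ::
  "'a measure \<Rightarrow> ('a \<Rightarrow> real) set \<Rightarrow> ('a \<Rightarrow> real) set \<Rightarrow> ('a \<Rightarrow> real) set \<Rightarrow> ('a \<Rightarrow> real) set" where
  "c_hull P E F K = weak_topology P E F closure_of s_hull P E K"

lemma s_hull_eq:
  assumes "K \<subseteq> E_space P M" "M \<noteq> {}"
  shows "s_hull P (E_space P M) K = {x \<in> E_space P M. \<exists>g\<in>K. AE \<omega> in P. x \<omega> \<le> g \<omega>}"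
proof -
  have diff: "(\<lambda>\<omega>. f \<omega> - g \<omega>) \<in> E_space P M" if "f \<in> E_space P M" "g \<in> E_space P M" for f g
    using that assms(2) by (auto simp: E_space_def L1_def L0_def intro!: borel_measurable_diff)
  show ?thesis
  proof (intro equalityI subsetI)
    fix x assume "x \<in> s_hull P (E_space P M) K"
    then obtain g y where "g \<in> K" "y \<in> nonneg_part P (E_space P M)" "x = (\<lambda>\<omega>. g \<omega> - y \<omega>)"
      unfolding s_hull_def by auto
    then show "x \<in> {x \<in> E_space P M. \<exists>g\<in>K. AE \<omega> in P. x \<omega> \<le> g \<omega>}"
      using diff assms(1) by (auto simp: nonneg_part_def intro!: bexI[of _ g])
  next
    fix x assume "x \<in> {x \<in> E_space P M. \<exists>g\<in>K. AE \<omega> in P. x \<omega> \<le> g \<omega>}"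
    then obtain g where g: "x \<in> E_space P M" "g \<in> K" "AE \<omega> in P. x \<omega> \<le> g \<omega>" by auto
    then have "(\<lambda>\<omega>. g \<omega> - x \<omega>) \<in> nonneg_part P (E_space P M)"
      using diff assms(1) by (auto simp: nonneg_part_def)
    then show "x \<in> s_hull P (E_space P M) K"
      unfolding s_hull_def using g(2)
      by (intro CollectI exI[of _ g] exI[of _ "\<lambda>\<omega>. g \<omega> - x \<omega>"]) auto
  qed
qed

end

theory Submission
  imports Defs
begin

text \<open>
  Every \<open>R(Q)\<close>, \<open>Q \<in> M\<close>, is nonpositive on \<open>s\<^sub>E(K)\<close>, hence on its closure. Conversely, a basic
  neighbourhood of a point \<open>z\<close> outside the closure involves finitely many functionals, so a
  finite-dimensional separation argument yields \<open>w \<in> F\<close> with \<open>\<langle>z, w\<rangle> > 0\<close> and \<open>w \<le> 0\<close> on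
  \<open>s\<^sub>E(K)\<close>. Testing against \<open>-E\<^sub>+\<close> gives \<open>w \<ge> 0\<close>, so \<open>w\<close> is a multiple of the density of some
  \<open>Q \<in> M\<^sub>1\<close>. Since \<open>w\<close> is a difference of multiples of two densities of measures in \<open>M\<close>, the face
  property puts \<open>Q\<close> in \<open>M\<close>, contradicting \<open>\<langle>z, R(Q)\<rangle> \<le> 0\<close>.
\<close>

section \<open>Separating a point from a convex cone in finitely many coordinates\<close>

text \<open>A first-order condition: dividing a quadratic minimality inequality by the step size
  \<open>t\<close> leaves \<open>2 * p \<le> t * q\<close>, and small \<open>t\<close> reveals the
  sign of the slope.\<close>

lemma nonpos_if_le_all_small_multiples:
  fixes p q :: real
  assumes "0 \<le> q" and le: "\<And>t. 0 < t \<Longrightarrow> t \<le> 1 \<Longrightarrow> 2 * p \<le> t * q"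
  shows "p \<le> 0"
proof (rule ccontr)
  assume "\<not> p \<le> 0"
  then have p: "p > 0" by simp
  define t where "t = min 1 (p / (q + 1))"
  have "t * q \<le> p / (q + 1) * q"
    using \<open>0 \<le> q\<close> by (intro mult_right_mono) (auto simp: t_def)
  also have "\<dots> \<le> p" using p \<open>0 \<le> q\<close> by (simp add: field_simps)
  finally have "t * q \<le> p" .
  moreover have "0 < t" "t \<le> 1" using p \<open>0 \<le> q\<close> by (auto simp: t_def)
  ultimately show False using le[of t] p by simp
qed

text \<open>
  The functional is \<open>z - l\<close>, where \<open>l\<close> is the nearest point to \<open>z\<close> in the closure of the cone, obtained
  from a minimizing sequence. The library's separation theorems need a Euclidean space type, while
  here the dimension is the cardinality of a set.
\<close>

lemma convex_cone_separation:
  fixes S :: "('i \<Rightarrow> real) set"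
  assumes "S \<noteq> {}" and "0 < e"
    and add: "\<And>x y. x \<in> S \<Longrightarrow> y \<in> S \<Longrightarrow> (\<lambda>i. x i + y i) \<in> S"
    and scale: "\<And>x c. x \<in> S \<Longrightarrow> 0 \<le> c \<Longrightarrow> (\<lambda>i. c * x i) \<in> S"
    and far: "\<And>x. x \<in> S \<Longrightarrow> e \<le> (\<Sum>i\<in>I. (z i - x i)\<^sup>2)"
    and "finite I"
  obtains a where "0 < (\<Sum>i\<in>I. a i * z i)" and "\<And>x. x \<in> S \<Longrightarrow> (\<Sum>i\<in>I. a i * x i) \<le> 0"
proof -
  \<comment> \<open>\<open>N\<close> is the squared Euclidean distance to \<open>z\<close> on the
    coordinates \<open>I\<close>, and \<open>d\<close> is its infimum over \<open>S\<close>.\<close>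
  define N where "N x = (\<Sum>i\<in>I. (z i - x i)\<^sup>2)" for x
  define d where "d = Inf (N ` S)"
  have d_le: "d \<le> N x" if "x \<in> S" for x
    unfolding d_def using that far by (intro cInf_lower bdd_belowI[of _ e]) (auto simp: N_def)
  have e_le: "e \<le> d"
    unfolding d_def using \<open>S \<noteq> {}\<close> far by (intro cInf_greatest) (auto simp: N_def)
  have "\<exists>x\<in>S. N x < d + inverse (Suc n)" for n :: nat
  proof -
    have "\<exists>v\<in>N ` S. v < d + inverse (Suc n)"
      using \<open>S \<noteq> {}\<close> by (intro cInf_lessD) (auto simp: d_def)
    then show ?thesis by auto
  qed
  then obtain x where x: "x n \<in> S" "N (x n) < d + inverse (Suc n)" for n
    by metis
  \<comment> \<open>The parallelogram law for \<open>z - u\<close> and \<open>z - v\<close>.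
    Midpoints of points of \<open>S\<close> stay in \<open>S\<close>, so their \<open>N\<close> is
    at least \<open>d\<close>; near-minimizers are therefore close together, and each coordinate in
    \<open>I\<close> is a Cauchy sequence.\<close>
  have parallelogram: "(\<Sum>i\<in>I. (u i - v i)\<^sup>2) = 2 * N u + 2 * N v - 4 * N (\<lambda>i. 1 / 2 * (u i + v i))" for u v
    unfolding N_def sum_distrib_left sum.distrib[symmetric] sum_subtractf[symmetric]
    by (intro sum.cong) (auto simp: power2_eq_square field_simps)
  have dist_le: "(x n i - x m i)\<^sup>2 \<le> 2 * inverse (Suc n) + 2 * inverse (Suc m)" if "i \<in> I" for i m n
  proof -
    have "(x n i - x m i)\<^sup>2 \<le> (\<Sum>i\<in>I. (x n i - x m i)\<^sup>2)"
      using that \<open>finite I\<close> by (intro member_le_sum) auto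
    moreover have "d \<le> N (\<lambda>i. 1 / 2 * (x n i + x m i))"
      by (intro d_le scale add x) auto
    ultimately show ?thesis
      using x(2)[of n] x(2)[of m] parallelogram[of "x n" "x m"] by linarith
  qed
  have "convergent (\<lambda>n. x n i)" if "i \<in> I" for i
  proof -
    have "Cauchy (\<lambda>n. x n i)"
    proof (rule metric_CauchyI)
      fix r :: real assume "0 < r"
      \<comment> \<open>Each of the two terms of \<open>dist_le\<close> carries a factor 2, so
        \<open>r\<^sup>2 / 4\<close> keeps their sum below \<open>r\<^sup>2\<close>.\<close>
      obtain k where k: "inverse (real (Suc k)) < r\<^sup>2 / 4"
        using reals_Archimedean[of "r\<^sup>2 / 4"] \<open>0 < r\<close> by auto
      have inv_le: "inverse (real (Suc n)) \<le> inverse (real (Suc k))" if "k \<le> n" for n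
        using that by (intro le_imp_inverse_le) auto
      have "dist (x m i) (x n i) < r" if "k \<le> m" "k \<le> n" for m n
      proof -
        have "(x m i - x n i)\<^sup>2 < r\<^sup>2"
          using dist_le[OF \<open>i \<in> I\<close>, of m n] inv_le[OF that(1)] inv_le[OF that(2)] k by linarith
        then have "\<bar>x m i - x n i\<bar>\<^sup>2 < r\<^sup>2" by simp
        then show ?thesis
          unfolding dist_real_def using \<open>0 < r\<close> by (intro power_less_imp_less_base[of _ 2 r]) auto
      qed
      then show "\<exists>k. \<forall>m\<ge>k. \<forall>n\<ge>k. dist (x m i) (x n i) < r" by blast
    qed
    then show ?thesis by (rule Cauchy_convergent)
  qed
  then obtain l where l: "(\<lambda>n. x n i) \<longlonglongrightarrow> l i" if "i \<in> I" for i
    unfolding convergent_def by metis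
  \<comment> \<open>The limit \<open>l\<close> may lie outside \<open>S\<close>. As a finite sum,
    \<open>N\<close> passes to the limit, so nonnegative combinations of \<open>l\<close> with
    points of \<open>S\<close> inherit the lower bound \<open>d\<close>.\<close>
  have N_lim: "(\<lambda>n. N (\<lambda>i. c * x n i + t * y i)) \<longlonglongrightarrow> N (\<lambda>i. c * l i + t * y i)" for c t y
    unfolding N_def by (intro tendsto_intros l)
  have N_ge: "d \<le> N (\<lambda>i. c * l i + t * y i)" if "y \<in> S" "0 \<le> t" "0 \<le> c" for c t y
    using that by (intro tendsto_lowerbound[OF N_lim] always_eventually allI d_le add scale x) auto
  have "N l \<le> d"
  proof (rule tendsto_le)
    show "(\<lambda>n. N (x n)) \<longlonglongrightarrow> N l" using N_lim[of 1 0] by simp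
    show "(\<lambda>n. d + inverse (real (Suc n))) \<longlonglongrightarrow> d"
      using tendsto_add[OF tendsto_const LIMSEQ_inverse_real_of_nat, of d] by simp
    show "\<forall>\<^sub>F n in sequentially. N (x n) \<le> d + inverse (real (Suc n))"
      using x(2) by (auto intro!: always_eventually less_imp_le)
  qed simp
  define a where "a i = z i - l i" for i
  have expand: "N (\<lambda>i. l i + t * y i) = N l - 2 * t * (\<Sum>i\<in>I. a i * y i) + t\<^sup>2 * (\<Sum>i\<in>I. (y i)\<^sup>2)" for t y
    unfolding N_def sum_distrib_left sum.distrib[symmetric] sum_subtractf[symmetric]
    by (intro sum.cong) (auto simp: power2_eq_square algebra_simps a_def)
  \<comment> \<open>If moving from \<open>l\<close> along \<open>y\<close> never takes
    \<open>N\<close> below its value at \<open>l\<close>, the slope at \<open>t = 0\<close>, which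
    is \<open>-2\<close> times this sum, is nonnegative.\<close>
  have nonpos: "(\<Sum>i\<in>I. a i * y i) \<le> 0" if "\<And>t. 0 < t \<Longrightarrow> t \<le> 1 \<Longrightarrow> d \<le> N (\<lambda>i. l i + t * y i)" for y
  proof (rule nonpos_if_le_all_small_multiples)
    show "0 \<le> (\<Sum>i\<in>I. (y i)\<^sup>2)" by (intro sum_nonneg) auto
    fix t :: real assume t: "0 < t" "t \<le> 1"
    have "t * (2 * (\<Sum>i\<in>I. a i * y i)) \<le> t * (t * (\<Sum>i\<in>I. (y i)\<^sup>2))"
      using that[OF t] expand[of t y] \<open>N l \<le> d\<close> by (simp add: power2_eq_square algebra_simps)
    then show "2 * (\<Sum>i\<in>I. a i * y i) \<le> t * (\<Sum>i\<in>I. (y i)\<^sup>2)"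
      using t(1) by (rule mult_left_le_imp_le)
  qed
  show thesis
  proof (rule that)
    fix y assume "y \<in> S"
    then show "(\<Sum>i\<in>I. a i * y i) \<le> 0"
      using N_ge[of y _ 1] by (intro nonpos) auto
  next
    obtain y where "y \<in> S" using \<open>S \<noteq> {}\<close> by auto
    \<comment> \<open>The direction \<open>- l\<close> is admissible because
      \<open>(1 - t) * l\<close> is a nonnegative multiple of \<open>l\<close>. Hence the pairing of
      \<open>a\<close> with \<open>l\<close> is nonnegative, and the pairing with \<open>z\<close>
      exceeds \<open>N l \<ge> d > 0\<close> by that amount.\<close>
    have "(\<Sum>i\<in>I. a i * (- l i)) \<le> 0"
    proof (rule nonpos)
      fix t :: real assume "0 < t" "t \<le> 1"
      then have "d \<le> N (\<lambda>i. (1 - t) * l i + 0 * y i)" by (intro N_ge \<open>y \<in> S\<close>) auto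
      then show "d \<le> N (\<lambda>i. l i + t * - l i)" by (simp add: algebra_simps)
    qed
    moreover have "d \<le> N l" using N_ge[OF \<open>y \<in> S\<close>, of 0 1] by simp
    moreover have "(\<Sum>i\<in>I. a i * z i) = N l - (\<Sum>i\<in>I. a i * (- l i))"
      unfolding N_def sum_subtractf[symmetric]
      by (intro sum.cong) (auto simp: power2_eq_square algebra_simps a_def)
    ultimately show "0 < (\<Sum>i\<in>I. a i * z i)" using e_le \<open>0 < e\<close> by linarith
  qed
qed

section \<open>Basic neighbourhoods of the weak topology\<close>

text \<open>Induction on the generation of \<open>U\<close>: a subbasic set needs one functional, an
  intersection joins the two sets of functionals and takes the smaller radius, and a union keeps the
  neighbourhood from a member containing \<open>z\<close>.\<close>

lemma weak_topology_neighbourhood: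
  assumes "openin (weak_topology P E F) U" and "z \<in> U"
  obtains T e where "finite T" "T \<subseteq> F" "0 < e"
    "{x \<in> E. \<forall>w\<in>T. \<bar>bform P x w - bform P z w\<bar> < e} \<subseteq> U"
proof -
  let ?basic = "\<lambda>T e. {x \<in> E. \<forall>w\<in>T. \<bar>bform P x w - bform P z w\<bar> < e}"
  have "generate_topology_on {{z \<in> E. bform P z w \<in> U} | w U. w \<in> F \<and> open U} U"
    using assms(1) unfolding weak_topology_def by (rule openin_topology_generated_by)
  then have "z \<in> U \<longrightarrow> (\<exists>T e. finite T \<and> T \<subseteq> F \<and> 0 < e \<and> ?basic T e \<subseteq> U)"
  proof induction
    case (Int A B)
    show ?case
    proof
      assume "z \<in> A \<inter> B"
      with Int.IH obtain T e T' e' where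
        "finite T" "T \<subseteq> F" "0 < e" "?basic T e \<subseteq> A"
        "finite T'" "T' \<subseteq> F" "0 < e'" "?basic T' e' \<subseteq> B"
        by auto
      moreover from this have "?basic (T \<union> T') (min e e') \<subseteq> A \<inter> B" by auto
      ultimately show "\<exists>T e. finite T \<and> T \<subseteq> F \<and> 0 < e \<and> ?basic T e \<subseteq> A \<inter> B"
        by (intro exI[of _ "T \<union> T'"] exI[of _ "min e e'"]) auto
    qed
  next
    case (UN A)
    then show ?case by (meson Union_iff Union_upper subset_trans)
  next
    case (Basis s)
    then obtain w V where w: "w \<in> F" "open V" "s = {z \<in> E. bform P z w \<in> V}" by auto
    show ?case
    proof
      assume "z \<in> s"
      then obtain e where "0 < e" "\<And>v. dist v (bform P z w) < e \<Longrightarrow> v \<in> V"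
        using w(2,3) unfolding open_dist by auto
      then show "\<exists>T e. finite T \<and> T \<subseteq> F \<and> 0 < e \<and> ?basic T e \<subseteq> s"
        using w by (intro exI[of _ "{w}"] exI[of _ e]) (auto simp: dist_real_def)
    qed
  qed simp
  with \<open>z \<in> U\<close> that show thesis by blast
qed

section \<open>Mixtures of measures and real-valued densities\<close>

lemma mix_measure_density:
  fixes f g :: "'a \<Rightarrow> real"
  assumes [measurable]: "f \<in> borel_measurable P" "g \<in> borel_measurable P"
    and nonneg: "\<And>x. 0 \<le> f x" "\<And>x. 0 \<le> g x" and \<alpha>: "0 \<le> \<alpha>" "\<alpha> \<le> 1"
  shows "mix_measure \<alpha> (density P f) (density P g) = density P (\<lambda>x. \<alpha> * f x + (1 - \<alpha>) * g x)"
proof (rule measure_eqI)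
  fix A assume "A \<in> sets (mix_measure \<alpha> (density P f) (density P g))"
  then have [measurable]: "A \<in> sets P" by (simp add: sets_mix_measure)
  have "emeasure (density P (\<lambda>x. \<alpha> * f x + (1 - \<alpha>) * g x)) A =
      (\<integral>\<^sup>+x. ennreal \<alpha> * (ennreal (f x) * indicator A x) + ennreal (1 - \<alpha>) * (ennreal (g x) * indicator A x) \<partial>P)"
    using nonneg \<alpha> by (subst emeasure_density)
      (auto intro!: nn_integral_cong simp: ennreal_plus ennreal_mult split: split_indicator)
  also have "\<dots> = ennreal \<alpha> * emeasure (density P f) A + ennreal (1 - \<alpha>) * emeasure (density P g) A"
    by (simp add: nn_integral_add nn_integral_cmult emeasure_density)
  finally show "emeasure (mix_measure \<alpha> (density P f) (density P g)) A =
      emeasure (density P (\<lambda>x. \<alpha> * f x + (1 - \<alpha>) * g x)) A"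
    by (simp add: emeasure_mix_measure)
qed (simp add: sets_mix_measure)

lemma R_nonneg: "0 \<le> R P Q x"
  by (simp add: R_def)

lemma borel_measurable_R [measurable]: "R P Q \<in> borel_measurable P"
  unfolding R_def by measurable

context prob_space
begin

text \<open>The derivative of a finite measure is finite almost everywhere, so
  \<open>enn2real\<close>, which sends infinity to 0, changes it only on a null set.\<close>

lemma density_R:
  assumes "Q \<in> ac_probs M"
  shows "density M (R M Q) = Q"
proof -
  interpret Q: prob_space Q using assms by (simp add: ac_probs_def)
  have ac: "absolutely_continuous M Q" "sets Q = sets M" using assms by (auto simp: ac_probs_def)
  have "AE x in M. RN_deriv M Q x \<noteq> \<infinity>"
    by (rule RN_deriv_finite[OF _ ac]) unfold_locales
  then have "density M (R M Q) = density M (RN_deriv M Q)"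
    unfolding R_def by (intro density_cong) (auto simp: less_top)
  then show ?thesis using density_RN_deriv[OF ac] by simp
qed

lemma R_unique:
  fixes f :: "'a \<Rightarrow> real"
  assumes "f \<in> borel_measurable M" "AE x in M. 0 \<le> f x" "density M f = Q"
  shows "AE x in M. f x = R M Q x"
proof -
  have "AE x in M. ennreal (f x) = RN_deriv M Q x"
    using assms by (intro RN_deriv_unique) auto
  with assms(2) show ?thesis by eventually_elim (metis R_def enn2real_ennreal)
qed

lemma
  assumes "Q \<in> ac_probs M" and [measurable]: "X \<in> borel_measurable M"
  shows integrable_mult_R_iff: "integrable M (\<lambda>x. X x * R M Q x) \<longleftrightarrow> integrable Q X"
    and bform_R: "bform M X (R M Q) = integral\<^sup>L Q X"
  using integrable_real_density[of "R M Q" M X] integral_real_density[of "R M Q" M X]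
  by (simp_all add: R_nonneg density_R[OF assms(1)] bform_def mult.commute)

lemma
  assumes "Q \<in> ac_probs M"
  shows integrable_R: "integrable M (R M Q)" and integral_R: "integral\<^sup>L M (R M Q) = 1"
proof -
  interpret Q: prob_space Q using assms by (simp add: ac_probs_def)
  show "integrable M (R M Q)" using integrable_mult_R_iff[OF assms, of "\<lambda>_. 1"] by simp
  show "integral\<^sup>L M (R M Q) = 1"
    using bform_R[OF assms, of "\<lambda>_. 1"] by (simp add: bform_def Q.prob_space)
qed

lemma density_in_ac_probs:
  fixes f :: "'a \<Rightarrow> real"
  assumes [measurable]: "f \<in> borel_measurable M" and nn: "AE x in M. 0 \<le> f x"
    and int: "integrable M f" "integral\<^sup>L M f = 1"
  shows "density M f \<in> ac_probs M"
proof -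
  have "emeasure (density M f) (space (density M f)) = (\<integral>\<^sup>+x. ennreal (f x) \<partial>M)"
    by (auto simp: emeasure_density intro!: nn_integral_cong)
  also have "\<dots> = 1" using nn_integral_eq_integral[OF int(1) nn] int(2) by simp
  finally show ?thesis
    by (auto simp: ac_probs_def intro!: prob_spaceI absolutely_continuousI_density)
qed

lemma R_mix_measure:
  assumes "Q1 \<in> ac_probs M" "Q2 \<in> ac_probs M" "0 \<le> \<alpha>" "\<alpha> \<le> 1"
  shows "AE x in M. \<alpha> * R M Q1 x + (1 - \<alpha>) * R M Q2 x = R M (mix_measure \<alpha> Q1 Q2) x"
  using assms mix_measure_density[of "R M Q1" M "R M Q2" \<alpha>] R_nonneg[of M]
  by (intro R_unique) (auto simp: density_R)

section \<open>Cone and span of the densities, and the face property\<close>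

text \<open>For convex \<open>G\<close>, single multiples already form the whole convex cone
  generated by the densities. Membership is up to null sets and does not include
  measurability.\<close>

definition density_cone :: "'a measure set \<Rightarrow> ('a \<Rightarrow> real) set" where
  "density_cone G = {u. \<exists>a\<ge>0. \<exists>Q\<in>G. AE x in M. u x = a * R M Q x}"

text \<open>For convex nonempty \<open>G\<close> this is the linear span of the densities up to null
  sets, in a form using only two measures.\<close>

definition density_diff :: "'a measure set \<Rightarrow> ('a \<Rightarrow> real) set" where
  "density_diff G = {w. \<exists>u\<in>density_cone G. \<exists>v\<in>density_cone G. AE x in M. w x = u x - v x}"

lemma density_coneI:
  "0 \<le> a \<Longrightarrow> Q \<in> G \<Longrightarrow> AE x in M. u x = a * R M Q x \<Longrightarrow> u \<in> density_cone G"
  unfolding density_cone_def by blast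

lemma density_diffI:
  assumes "u \<in> density_cone G" "v \<in> density_cone G" "AE x in M. w x = u x - v x"
  shows "w \<in> density_diff G"
  using assms unfolding density_diff_def by blast

context
  fixes G :: "'a measure set"
  assumes G: "G \<noteq> {}" "G \<subseteq> ac_probs M"
    and mix: "\<And>Q1 Q2 \<alpha>. Q1 \<in> G \<Longrightarrow> Q2 \<in> G \<Longrightarrow> 0 \<le> \<alpha> \<Longrightarrow> \<alpha> \<le> 1 \<Longrightarrow> mix_measure \<alpha> Q1 Q2 \<in> G"
begin

lemma density_cone_zero: "(\<lambda>x. 0) \<in> density_cone G"
  using G(1) unfolding density_cone_def by auto

text \<open>Normalizing the weights turns \<open>a R(Q1) + b R(Q2)\<close> into \<open>a + b\<close>
  times the density of the mixture with weight \<open>a / (a + b)\<close>; \<open>a + b = 0\<close>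
  is handled apart.\<close>

lemma density_cone_add:
  assumes "u \<in> density_cone G" "v \<in> density_cone G"
  shows "(\<lambda>x. u x + v x) \<in> density_cone G"
proof -
  obtain a b Q1 Q2 where *: "0 \<le> a" "0 \<le> b" "Q1 \<in> G" "Q2 \<in> G"
    "AE x in M. u x = a * R M Q1 x" "AE x in M. v x = b * R M Q2 x"
    using assms unfolding density_cone_def by auto
  show ?thesis
  proof (cases "a + b = 0")
    case True
    then have "a = 0" "b = 0" using * by auto
    with * show ?thesis by (intro density_coneI[of 0 Q1]) auto
  next
    case False
    define \<alpha> where "\<alpha> = a / (a + b)"
    have \<alpha>: "0 \<le> \<alpha>" "\<alpha> \<le> 1" and [simp]: "(a + b) * \<alpha> = a" "(a + b) * (1 - \<alpha>) = b"
      using False * by (auto simp: \<alpha>_def field_simps)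
    have "AE x in M. \<alpha> * R M Q1 x + (1 - \<alpha>) * R M Q2 x = R M (mix_measure \<alpha> Q1 Q2) x"
      using * \<alpha> G by (intro R_mix_measure) auto
    with *(5,6) have "AE x in M. u x + v x = (a + b) * R M (mix_measure \<alpha> Q1 Q2) x"
    proof eventually_elim
      case (elim x)
      have "(a + b) * R M (mix_measure \<alpha> Q1 Q2) x
          = ((a + b) * \<alpha>) * R M Q1 x + ((a + b) * (1 - \<alpha>)) * R M Q2 x"
        unfolding elim(3)[symmetric] by (simp only: distrib_left mult.assoc)
      then show ?case using elim by simp
    qed
    moreover have "mix_measure \<alpha> Q1 Q2 \<in> G" using * \<alpha> by (intro mix) auto
    moreover have "0 \<le> a + b" using * by simp
    ultimately show ?thesis by (intro density_coneI)
  qed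
qed

lemma density_cone_scale:
  assumes "u \<in> density_cone G" "0 \<le> c"
  shows "(\<lambda>x. c * u x) \<in> density_cone G"
proof -
  obtain a Q where *: "0 \<le> a" "Q \<in> G" "AE x in M. u x = a * R M Q x"
    using assms unfolding density_cone_def by auto
  then have "AE x in M. c * u x = (c * a) * R M Q x" by auto
  with * \<open>0 \<le> c\<close> show ?thesis by (intro density_coneI[of "c * a" Q]) auto
qed

lemma density_diff_add:
  assumes "w \<in> density_diff G" "w' \<in> density_diff G"
  shows "(\<lambda>x. w x + w' x) \<in> density_diff G"
proof -
  obtain u v u' v' where *: "u \<in> density_cone G" "v \<in> density_cone G" "u' \<in> density_cone G" "v' \<in> density_cone G"
    and eq: "AE x in M. w x = u x - v x" "AE x in M. w' x = u' x - v' x"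
    using assms unfolding density_diff_def by auto
  from eq have "AE x in M. w x + w' x = (u x + u' x) - (v x + v' x)" by eventually_elim simp
  with * show ?thesis
    by (intro density_diffI[of "\<lambda>x. u x + u' x" _ "\<lambda>x. v x + v' x"] density_cone_add)
qed

lemma density_diff_scale:
  assumes "w \<in> density_diff G"
  shows "(\<lambda>x. c * w x) \<in> density_diff G"
proof -
  obtain u v where *: "u \<in> density_cone G" "v \<in> density_cone G"
    and eq: "AE x in M. w x = u x - v x"
    using assms unfolding density_diff_def by auto
  show ?thesis
  proof (cases "0 \<le> c")
    case True
    from eq have "AE x in M. c * w x = c * u x - c * v x"
      by eventually_elim (simp only: right_diff_distrib)
    with True * show ?thesis by (intro density_diffI[of "\<lambda>x. c * u x" _ "\<lambda>x. c * v x"] density_cone_scale)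
  next
    case False
    \<comment> \<open>A negative factor exchanges the two parts, so that both are scaled by
      \<open>- c \<ge> 0\<close>.\<close>
    from eq have "AE x in M. c * w x = - c * v x - - c * u x"
      by eventually_elim (simp add: right_diff_distrib)
    with False * show ?thesis
      by (intro density_diffI[of "\<lambda>x. - c * v x" _ "\<lambda>x. - c * u x"] density_cone_scale) auto
  qed
qed

lemma density_diff_sum:
  assumes "\<And>i. i \<in> T \<Longrightarrow> f i \<in> density_diff G"
  shows "(\<lambda>x. \<Sum>i\<in>T. c i * f i x) \<in> density_diff G"
  using assms
proof (induction T rule: infinite_finite_induct)
  case (insert i T)
  then show ?case by (simp add: density_diff_add density_diff_scale)
qed (auto intro!: density_diffI[OF density_cone_zero density_cone_zero])

lemma density_diff_R:
  assumes "Q \<in> G"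
  shows "R M Q \<in> density_diff G"
proof -
  have "R M Q \<in> density_cone G"
    using assms by (intro density_coneI[of 1]) auto
  then show ?thesis
    using density_cone_zero by (rule density_diffI) auto
qed

lemma F_space_subset_density_diff: "F_space M G \<subseteq> density_diff G"
proof
  fix w assume "w \<in> F_space M G"
  then obtain T c where T: "T \<subseteq> R M ` G" and eq: "AE x in M. w x = (\<Sum>f\<in>T. c f * f x)"
    unfolding F_space_def span_L0_def by auto
  have "(\<lambda>x. \<Sum>f\<in>T. c f * f x) \<in> density_diff G"
    using T density_diff_R by (intro density_diff_sum) auto
  then obtain u v where uv: "u \<in> density_cone G" "v \<in> density_cone G"
    and "AE x in M. (\<Sum>f\<in>T. c f * f x) = u x - v x"
    unfolding density_diff_def by auto
  with eq have "AE x in M. w x = u x - v x" by auto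
  with uv show "w \<in> density_diff G" by (rule density_diffI)
qed

lemma density_diffE:
  assumes "w \<in> density_diff G"
  obtains a b Q1 Q2 where "0 \<le> a" "0 \<le> b" "Q1 \<in> G" "Q2 \<in> G"
    "AE x in M. w x = a * R M Q1 x - b * R M Q2 x"
proof -
  obtain u v where "u \<in> density_cone G" "v \<in> density_cone G" and eq: "AE x in M. w x = u x - v x"
    using assms unfolding density_diff_def by auto
  then obtain a b Q1 Q2 where *: "0 \<le> a" "0 \<le> b" "Q1 \<in> G" "Q2 \<in> G"
    and "AE x in M. u x = a * R M Q1 x" "AE x in M. v x = b * R M Q2 x"
    unfolding density_cone_def by auto
  with eq have "AE x in M. w x = a * R M Q1 x - b * R M Q2 x" by auto
  with * show thesis by (rule that)
qed

text \<open>Up to null sets \<open>w\<close> combines two densities, and \<open>X * R M Q\<close> is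
  integrable because \<open>X\<close> is in \<open>L1(Q)\<close>. Pairings of \<open>E\<close> with
  \<open>F\<close> are thus genuine integrals, not the default value 0, and linearity may be
  used.\<close>

lemma integrable_mult_density_diff:
  assumes "w \<in> density_diff G" and [measurable]: "w \<in> borel_measurable M" and X: "X \<in> E_space M G"
  shows "integrable M (\<lambda>x. X x * w x)"
proof -
  have [measurable]: "X \<in> borel_measurable M"
    using X G(1) by (auto simp: E_space_def L1_def L0_def)
  obtain a b Q1 Q2 where *: "Q1 \<in> G" "Q2 \<in> G" and eq: "AE x in M. w x = a * R M Q1 x - b * R M Q2 x"
    using density_diffE[OF assms(1)] by metis
  have int: "integrable M (\<lambda>x. X x * R M Q x)" if "Q \<in> G" for Q
    using X that G by (subst integrable_mult_R_iff) (auto simp: E_space_def L1_def L0_def)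
  have int_diff: "integrable M (\<lambda>x. a * (X x * R M Q1 x) - b * (X x * R M Q2 x))"
    using * by (intro Bochner_Integration.integrable_diff integrable_mult_right int)
  have "AE x in M. a * (X x * R M Q1 x) - b * (X x * R M Q2 x) = X x * w x"
    using eq by eventually_elim (simp only: right_diff_distrib mult.left_commute)
  then show ?thesis by (intro integrable_cong_AE_imp[OF int_diff]) auto
qed

end

text \<open>
  With \<open>w = a R(Q\<^sub>1) - b R(Q\<^sub>2)\<close> and \<open>c = E w\<close>, normalizing \<open>w\<close> gives \<open>Q \<in> M\<^sub>1\<close> such that
  \<open>a R(Q\<^sub>1) = c R(Q) + b R(Q\<^sub>2)\<close>. So \<open>Q\<^sub>1\<close> is a proper convex combination of \<open>Q\<close> and \<open>Q\<^sub>2\<close>.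
\<close>

lemma face_density_coneI:
  assumes face: "face_of_measures G (M1 M K)" and "G \<noteq> {}"
    and w: "w \<in> density_diff G" and [measurable]: "w \<in> borel_measurable M"
    and nn: "AE x in M. 0 \<le> w x" and K: "\<And>X. X \<in> K \<Longrightarrow> bform M X w \<le> 0"
  shows "w \<in> density_cone G"
proof -
  have G: "G \<noteq> {}" "G \<subseteq> ac_probs M" and GM: "G \<subseteq> M1 M K"
    and mix: "\<And>Q1 Q2 \<alpha>. Q1 \<in> G \<Longrightarrow> Q2 \<in> G \<Longrightarrow> 0 \<le> \<alpha> \<Longrightarrow> \<alpha> \<le> 1 \<Longrightarrow> mix_measure \<alpha> Q1 Q2 \<in> G"
    and extreme: "\<And>Q1 Q2 \<alpha>. Q1 \<in> M1 M K \<Longrightarrow> Q2 \<in> M1 M K \<Longrightarrow> 0 < \<alpha> \<Longrightarrow> \<alpha> < 1 \<Longrightarrow>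
      mix_measure \<alpha> Q1 Q2 \<in> G \<Longrightarrow> Q1 \<in> G"
    using face \<open>G \<noteq> {}\<close> unfolding face_of_measures_def M1_def by blast+
  obtain a b Q1 Q2 where ab: "0 \<le> a" "0 \<le> b" and Q12: "Q1 \<in> G" "Q2 \<in> G"
    and eq: "AE x in M. w x = a * R M Q1 x - b * R M Q2 x"
    by (rule density_diffE[OF G mix w])
  have ac: "Q1 \<in> ac_probs M" "Q2 \<in> ac_probs M" using Q12 G by auto
  have int_diff: "integrable M (\<lambda>x. a * R M Q1 x - b * R M Q2 x)"
    using ac by (intro Bochner_Integration.integrable_diff integrable_mult_right integrable_R)
  then have int: "integrable M w"
    using eq by (intro integrable_cong_AE_imp[OF int_diff]) auto
  define c where "c = integral\<^sup>L M w"
  \<comment> \<open>Both densities integrate to 1, so the mass of \<open>w\<close> is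
    \<open>a - b\<close>; hence \<open>c / a\<close> and \<open>b / a\<close> sum to 1 when
    \<open>a > 0\<close>.\<close>
  have "c = integral\<^sup>L M (\<lambda>x. a * R M Q1 x - b * R M Q2 x)"
    unfolding c_def using eq by (intro integral_cong_AE) auto
  also have "\<dots> = a - b"
    using ac by (simp add: integrable_R integral_R)
  finally have c: "c = a - b" .
  have "0 \<le> c" unfolding c_def using nn by (rule integral_nonneg_AE)
  show ?thesis
  \<comment> \<open>If \<open>c = 0\<close> then \<open>w\<close> vanishes almost everywhere, and if
    \<open>b = 0\<close> it is a multiple of \<open>R M Q1\<close>. Otherwise
    \<open>0 < c < a\<close>, so the weight \<open>c / a\<close> is strictly between 0 and 1, as the
    face property demands.\<close>
  proof (cases "c = 0 \<or> b = 0")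
    case True
    then show ?thesis
    proof
      assume "c = 0"
      then have "AE x in M. w x = 0"
        using integral_nonneg_eq_0_iff_AE[OF int nn] by (simp add: c_def)
      then show ?thesis using Q12 by (intro density_coneI[of 0 Q1]) auto
    next
      assume "b = 0"
      then show ?thesis using ab Q12 eq by (intro density_coneI[of a Q1]) auto
    qed
  next
    case False
    then have "0 < c" "0 < b" "c < a" "0 < a" using \<open>0 \<le> c\<close> ab c by auto
    define Q where "Q = density M (\<lambda>x. ennreal (w x / c))"
    have nn': "AE x in M. 0 \<le> w x / c" using nn by eventually_elim (use \<open>0 < c\<close> in auto)
    have acQ: "Q \<in> ac_probs M"
      unfolding Q_def using nn' int \<open>0 < c\<close>
      by (intro density_in_ac_probs) (auto simp: c_def[symmetric])
    have RQ: "AE x in M. w x / c = R M Q x"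
      using nn' by (intro R_unique) (auto simp: Q_def)
    have "Q \<in> M1 M K"
    proof -
      have "integrable Q X \<and> integral\<^sup>L Q X \<le> 0 \<and> X \<in> L0 M" if "X \<in> K" for X
      proof -
        \<comment> \<open>All measures in \<open>G\<close> integrate \<open>X\<close>, so
          \<open>X * w\<close> is integrable; then the mean of \<open>X\<close> under
          \<open>Q\<close> is \<open>bform M X w / c\<close>, which is nonpositive.\<close>
        have XE: "X \<in> E_space M G" using GM \<open>X \<in> K\<close> by (auto simp: E_space_def M1_def)
        then have [measurable]: "X \<in> borel_measurable M"
          using \<open>G \<noteq> {}\<close> by (auto simp: E_space_def L1_def L0_def)
        have XR: "AE x in M. X x * w x / c = X x * R M Q x"
          using RQ by eventually_elim (metis times_divide_eq_right)
        have int_Xw: "integrable M (\<lambda>x. X x * w x / c)"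
          using integrable_mult_density_diff[OF G mix w _ XE] by simp
        have "integrable M (\<lambda>x. X x * R M Q x)"
          using XR by (intro integrable_cong_AE_imp[OF int_Xw]) auto
        moreover have "integral\<^sup>L Q X = bform M X w / c"
          using integral_cong_AE[OF _ _ XR] by (simp add: bform_R[OF acQ, symmetric] bform_def)
        ultimately show ?thesis
          using K[OF that] \<open>0 < c\<close>
          by (simp add: integrable_mult_R_iff[OF acQ] divide_nonpos_pos L0_def)
      qed
      then show ?thesis using acQ by (auto simp: M1_def L1_def)
    qed
    moreover have "mix_measure (c / a) Q Q2 = Q1"
    proof -
      have "mix_measure (c / a) Q Q2 = density M (\<lambda>x. c / a * R M Q x + (1 - c / a) * R M Q2 x)"
        using mix_measure_density[of "R M Q" M "R M Q2" "c / a"] R_nonneg[of M] \<open>0 < c\<close> \<open>c < a\<close>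
        by (simp add: density_R acQ ac)
      also have "\<dots> = density M (R M Q1)"
      proof (rule density_cong)
        have "AE x in M. c / a * R M Q x + (1 - c / a) * R M Q2 x = R M Q1 x"
          using eq RQ
        proof eventually_elim
          case (elim x)
          have "1 - c / a = b / a" using c \<open>0 < a\<close> by (simp add: field_simps)
          then have "c / a * R M Q x + (1 - c / a) * R M Q2 x = (c * R M Q x + b * R M Q2 x) / a"
            by (simp add: add_divide_distrib)
          also have "c * R M Q x = w x" using elim(2) \<open>0 < c\<close> by (simp add: field_simps)
          also have "(w x + b * R M Q2 x) / a = R M Q1 x" using elim(1) \<open>0 < a\<close> by simp
          finally show ?case .
        qed
        then show "AE x in M. ennreal (c / a * R M Q x + (1 - c / a) * R M Q2 x) = ennreal (R M Q1 x)"
          by eventually_elim simp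
      qed auto
      finally show ?thesis using ac by (simp add: density_R)
    qed
    ultimately have "Q \<in> G"
      using extreme[of Q Q2 "c / a"] GM Q12 \<open>0 < c\<close> \<open>c < a\<close> by auto
    then show ?thesis
      using RQ \<open>0 < c\<close> by (intro density_coneI[of c Q]) (auto elim!: eventually_mono simp: field_simps)
  qed
qed

end

section \<open>Cone operations on \<open>E\<close>, \<open>K\<close> and
  \<open>s_E(K)\<close>\<close>

lemma E_space_add:
  "x \<in> E_space P M \<Longrightarrow> y \<in> E_space P M \<Longrightarrow> (\<lambda>\<omega>. x \<omega> + y \<omega>) \<in> E_space P M"
  by (auto simp: E_space_def L1_def L0_def intro: borel_measurable_add)

lemma E_space_scale: "x \<in> E_space P M \<Longrightarrow> (\<lambda>\<omega>. c * x \<omega>) \<in> E_space P M"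
  by (auto simp: E_space_def L1_def L0_def)

lemma wedge_L0_scale: "wedge_L0 P K \<Longrightarrow> X \<in> K \<Longrightarrow> 0 \<le> c \<Longrightarrow> (\<lambda>\<omega>. c * X \<omega>) \<in> K"
  unfolding wedge_L0_def by blast

text \<open>The sum is twice the midpoint, so convexity and scaling suffice.\<close>

lemma wedge_L0_add:
  assumes "wedge_L0 P K" "X \<in> K" "Y \<in> K"
  shows "(\<lambda>\<omega>. X \<omega> + Y \<omega>) \<in> K"
proof -
  have "(\<lambda>\<omega>. 1 / 2 * X \<omega> + (1 - 1 / 2) * Y \<omega>) \<in> K"
    using assms unfolding wedge_L0_def by (elim conjE ballE allE[of _ "1 / 2"]) auto
  from wedge_L0_scale[OF assms(1) this, of 2] show ?thesis by (simp add: distrib_left)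
qed

lemma wedge_L0_zero: "wedge_L0 P K \<Longrightarrow> (\<lambda>\<omega>. 0) \<in> K"
  using wedge_L0_scale[of P K _ 0] unfolding wedge_L0_def by auto

lemma s_hull_add:
  assumes "wedge_L0 P K" and xy: "x \<in> s_hull P (E_space P M) K" "y \<in> s_hull P (E_space P M) K"
  shows "(\<lambda>\<omega>. x \<omega> + y \<omega>) \<in> s_hull P (E_space P M) K"
proof -
  obtain g h u v where *: "g \<in> K" "h \<in> K" "u \<in> nonneg_part P (E_space P M)" "v \<in> nonneg_part P (E_space P M)"
    and eq: "x = (\<lambda>\<omega>. g \<omega> - u \<omega>)" "y = (\<lambda>\<omega>. h \<omega> - v \<omega>)"
    using xy unfolding s_hull_def by auto
  have "(\<lambda>\<omega>. u \<omega> + v \<omega>) \<in> nonneg_part P (E_space P M)"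
    using * by (auto simp: nonneg_part_def intro: E_space_add)
  moreover have "(\<lambda>\<omega>. x \<omega> + y \<omega>) = (\<lambda>\<omega>. (g \<omega> + h \<omega>) - (u \<omega> + v \<omega>))"
    by (auto simp: eq)
  ultimately show ?thesis
    using wedge_L0_add[OF assms(1) *(1,2)] unfolding s_hull_def by (intro CollectI exI conjI)
qed

lemma s_hull_scale:
  assumes "wedge_L0 P K" and x: "x \<in> s_hull P (E_space P M) K" and "0 \<le> c"
  shows "(\<lambda>\<omega>. c * x \<omega>) \<in> s_hull P (E_space P M) K"
proof -
  obtain g u where *: "g \<in> K" "u \<in> nonneg_part P (E_space P M)"
    and eq: "x = (\<lambda>\<omega>. g \<omega> - u \<omega>)"
    using x unfolding s_hull_def by auto
  have "(\<lambda>\<omega>. c * u \<omega>) \<in> nonneg_part P (E_space P M)"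
    using * \<open>0 \<le> c\<close> by (auto simp: nonneg_part_def intro: E_space_scale)
  moreover have "(\<lambda>\<omega>. c * x \<omega>) = (\<lambda>\<omega>. c * g \<omega> - c * u \<omega>)"
    by (simp add: eq right_diff_distrib)
  ultimately show ?thesis
    using wedge_L0_scale[OF assms(1) *(1) \<open>0 \<le> c\<close>] unfolding s_hull_def by (intro CollectI exI conjI)
qed

section \<open>The polar and the weak closure: both inclusions\<close>

theorem proposition5p4:
  fixes P :: "'a measure" and K :: "('a \<Rightarrow> real) set" and M :: "'a measure set"
  assumes "prob_space P"
    and "wedge_L0 P K"
    and "M \<noteq> {}"
    and "face_of_measures M (M1 P K)"
  shows "polar P (E_space P M) (R P ` M) = c_hull P (E_space P M) (F_space P M) K"
proof -
  interpret prob_space P by fact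
  define E where "E = E_space P M"
  define F where "F = F_space P M"
  define S where "S = s_hull P E K"
  have M: "M \<subseteq> M1 P K" and M_ac: "M \<subseteq> ac_probs P"
    and mix: "\<And>Q1 Q2 \<alpha>. Q1 \<in> M \<Longrightarrow> Q2 \<in> M \<Longrightarrow> 0 \<le> \<alpha> \<Longrightarrow> \<alpha> \<le> 1 \<Longrightarrow> mix_measure \<alpha> Q1 Q2 \<in> M"
    using assms(4) unfolding face_of_measures_def M1_def by blast+
  have "K \<subseteq> E" using M by (auto simp: E_def E_space_def M1_def)
  then have S_eq: "S = {x \<in> E. \<exists>g\<in>K. AE \<omega> in P. x \<omega> \<le> g \<omega>}"
    unfolding S_def E_def using \<open>M \<noteq> {}\<close> by (rule s_hull_eq)
  have E_meas: "x \<in> borel_measurable P" if "x \<in> E" for x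
    using that \<open>M \<noteq> {}\<close> by (auto simp: E_def E_space_def L1_def L0_def)
  have RF: "R P Q \<in> F" if "Q \<in> M" for Q
    unfolding F_def F_space_def span_L0_def
    using that by (auto simp: L0_def intro!: exI[of _ "{R P Q}"] exI[of _ "\<lambda>_. 1"])
  then have "F \<noteq> {}" using \<open>M \<noteq> {}\<close> by auto
  note top = topspace_weak_topology[OF this, of P E]
  have F_diff: "F \<subseteq> density_diff M" and F_meas: "F \<subseteq> borel_measurable P"
    using F_space_subset_density_diff[OF \<open>M \<noteq> {}\<close> M_ac mix]
    by (auto simp: F_def F_space_def span_L0_def L0_def)
  have int_EF: "integrable P (\<lambda>\<omega>. x \<omega> * w \<omega>)" if "x \<in> E" "w \<in> F" for x w
    using that F_diff F_meas
    by (intro integrable_mult_density_diff[OF \<open>M \<noteq> {}\<close> M_ac mix]) (auto simp: E_def)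

  \<comment> \<open>Densities are nonnegative, so the pairing is monotone and passes from
    \<open>x\<close> to a dominating \<open>g\<close> in \<open>K\<close>, whose mean under
    \<open>Q\<close> is nonpositive.\<close>
  have S_le: "bform P x (R P Q) \<le> 0" if "x \<in> S" "Q \<in> M" for x Q
  proof -
    obtain g where g: "x \<in> E" "g \<in> K" "AE \<omega> in P. x \<omega> \<le> g \<omega>" using \<open>x \<in> S\<close> S_eq by auto
    then have "g \<in> E" using \<open>K \<subseteq> E\<close> by auto
    have "Q \<in> ac_probs P" "integral\<^sup>L Q g \<le> 0" using \<open>Q \<in> M\<close> M g by (auto simp: M1_def)
    have "bform P x (R P Q) \<le> bform P g (R P Q)"
      unfolding bform_def using g \<open>g \<in> E\<close> \<open>Q \<in> M\<close> RF
      by (intro integral_mono_AE int_EF) (auto intro!: mult_right_mono R_nonneg elim!: eventually_mono)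
    also have "\<dots> \<le> 0"
      using bform_R[OF \<open>Q \<in> ac_probs P\<close> E_meas[OF \<open>g \<in> E\<close>]] \<open>integral\<^sup>L Q g \<le> 0\<close> by simp
    finally show ?thesis .
  qed

  have "polar P E (R P ` M) = weak_topology P E F closure_of S"
  proof (intro equalityI subsetI)
    fix z assume z: "z \<in> weak_topology P E F closure_of S"
    have "z \<in> E" using z closure_of_subset_topspace top by fastforce
    moreover have "bform P z (R P Q) \<le> 0" if "Q \<in> M" for Q
    proof (rule ccontr)
      \<comment> \<open>An open half-space that misses \<open>S\<close> by \<open>S_le\<close>, yet
        would contain the closure point \<open>z\<close>.\<close>
      define U where "U = {x \<in> E. bform P x (R P Q) \<in> {0<..}}"
      assume "\<not> bform P z (R P Q) \<le> 0"
      then have "z \<in> U" using \<open>z \<in> E\<close> by (simp add: U_def)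
      moreover have "openin (weak_topology P E F) U"
        unfolding weak_topology_def U_def using RF[OF that]
        by (intro topology_generated_by_Basis CollectI exI[of _ "R P Q"] exI[of _ "{0<..}"]) auto
      ultimately obtain x where "x \<in> S" "x \<in> U"
        using z unfolding in_closure_of by metis
      then show False using S_le[OF _ that, of x] by (simp add: U_def)
    qed
    ultimately show "z \<in> polar P E (R P ` M)" by (auto simp: polar_def)
  next
    fix z assume "z \<in> polar P E (R P ` M)"
    then have "z \<in> E" and z_le: "\<And>Q. Q \<in> M \<Longrightarrow> bform P z (R P Q) \<le> 0" by (auto simp: polar_def)
    show "z \<in> weak_topology P E F closure_of S"
    proof (rule ccontr)
      assume "z \<notin> weak_topology P E F closure_of S"
      then obtain U where U: "openin (weak_topology P E F) U" "z \<in> U" "S \<inter> U = {}"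
        using \<open>z \<in> E\<close> top unfolding in_closure_of by blast
      from U(1,2) obtain T e where T: "finite T" "T \<subseteq> F" "0 < e"
        and TU: "{x \<in> E. \<forall>w\<in>T. \<bar>bform P x w - bform P z w\<bar> < e} \<subseteq> U"
        by (rule weak_topology_neighbourhood)
      \<comment> \<open>Coordinates of \<open>x\<close> in the finitely many functionals of
        \<open>T\<close>. The value 0 off \<open>T\<close> makes \<open>ev\<close> additive as an
        equality of functions, since integrability is known only for \<open>w\<close> in
        \<open>F\<close>.\<close>
      define ev where "ev x = (\<lambda>w. if w \<in> T then bform P x w else 0)" for x
      have ev_add: "(\<lambda>w. ev x w + ev y w) = ev (\<lambda>\<omega>. x \<omega> + y \<omega>)" if "x \<in> E" "y \<in> E" for x y
        using T(2) that by (auto simp: ev_def bform_def distrib_right int_EF subsetD)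
      have ev_scale: "(\<lambda>w. c * ev x w) = ev (\<lambda>\<omega>. c * x \<omega>)" for c x
        by (auto simp: ev_def bform_def mult.assoc)
      have "K \<subseteq> S" using \<open>K \<subseteq> E\<close> S_eq by auto
      have "S \<noteq> {}" using \<open>K \<subseteq> S\<close> wedge_L0_zero[OF assms(2)] by auto
      obtain a where pos: "0 < (\<Sum>w\<in>T. a w * ev z w)"
        and nonpos: "\<And>x. x \<in> ev ` S \<Longrightarrow> (\<Sum>w\<in>T. a w * x w) \<le> 0"
      proof (rule convex_cone_separation[of "ev ` S" "e\<^sup>2" "ev z" T])
        show "ev ` S \<noteq> {}" "0 < e\<^sup>2" "finite T" using T \<open>S \<noteq> {}\<close> by auto
        show "(\<lambda>w. x w + y w) \<in> ev ` S" if xy: "x \<in> ev ` S" "y \<in> ev ` S" for x y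
        proof -
          obtain x' y' where *: "x' \<in> S" "y' \<in> S" "x = ev x'" "y = ev y'" using xy by auto
          then have "(\<lambda>w. x w + y w) = ev (\<lambda>\<omega>. x' \<omega> + y' \<omega>)" using ev_add S_eq by simp
          then show ?thesis using s_hull_add[OF assms(2)] * unfolding S_def E_def by blast
        qed
        show "(\<lambda>w. c * x w) \<in> ev ` S" if xc: "x \<in> ev ` S" "0 \<le> c" for x c
          using xc s_hull_scale[OF assms(2)] unfolding S_def E_def by (auto simp: ev_scale)
        show "e\<^sup>2 \<le> (\<Sum>w\<in>T. (ev z w - x w)\<^sup>2)" if xS: "x \<in> ev ` S" for x
        proof -
          obtain x' where x': "x' \<in> S" "x = ev x'" using xS by auto
          \<comment> \<open>As \<open>x'\<close> misses the neighbourhood, some coordinate is off by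
            at least \<open>e\<close>, and this one square already gives the bound
            \<open>e\<^sup>2\<close>.\<close>
          then have "x' \<in> E" "x' \<notin> U" using U(3) S_eq by auto
          then have "\<not> (\<forall>w\<in>T. \<bar>bform P x' w - bform P z w\<bar> < e)" using TU by blast
          then obtain w where w: "w \<in> T" "e \<le> \<bar>bform P x' w - bform P z w\<bar>"
            by (auto simp: not_less)
          have "e\<^sup>2 \<le> \<bar>bform P x' w - bform P z w\<bar>\<^sup>2" using w T(3) by (intro power_mono) auto
          also have "\<dots> = (ev z w - x w)\<^sup>2" using w x' by (simp add: ev_def power2_commute)
          also have "\<dots> \<le> (\<Sum>w\<in>T. (ev z w - x w)\<^sup>2)" using w T(1) by (intro member_le_sum) auto
          finally show ?thesis .
        qed
      qed blast
      \<comment> \<open>The separating coefficients assemble into one function \<open>W\<close>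
        whose pairing with \<open>E\<close> is the separating functional.\<close>
      define W where "W \<omega> = (\<Sum>w\<in>T. a w * w \<omega>)" for \<omega>
      have W_diff: "W \<in> density_diff M"
        unfolding W_def using T(2) F_diff by (intro density_diff_sum[OF \<open>M \<noteq> {}\<close> M_ac mix]) auto
      have [measurable]: "W \<in> borel_measurable P"
        unfolding W_def using T(2) F_meas by (intro borel_measurable_sum borel_measurable_times) auto
      have bform_W: "bform P x W = (\<Sum>w\<in>T. a w * ev x w)" if "x \<in> E" for x
      proof -
        have "bform P x W = (\<integral>\<omega>. (\<Sum>w\<in>T. a w * (x \<omega> * w \<omega>)) \<partial>P)"
          by (simp add: bform_def W_def sum_distrib_left mult.left_commute)
        also have "\<dots> = (\<Sum>w\<in>T. a w * bform P x w)"
          using T(2) that by (subst Bochner_Integration.integral_sum) (auto simp: bform_def int_EF)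
        finally show ?thesis by (simp add: ev_def)
      qed
      have W_S: "bform P x W \<le> 0" if "x \<in> S" for x
        using that S_eq nonpos[of "ev x"] bform_W by auto
      have W_nonneg: "AE \<omega> in P. 0 \<le> W \<omega>"
      proof -
        \<comment> \<open>The test function is bounded, hence in \<open>E\<close>, and lies below
          \<open>0\<close> in \<open>K\<close>, hence in \<open>S\<close>. Since
          \<open>x * W \<ge> 0\<close> has nonpositive integral, it vanishes almost everywhere, so
          \<open>W < 0\<close> only on a null set.\<close>
        define x where "x = (\<lambda>\<omega>. - indicator {\<omega> \<in> space P. W \<omega> < 0} \<omega> :: real)"
        have [measurable]: "x \<in> borel_measurable P" unfolding x_def by measurable
        have "integrable Q x" if "Q \<in> M" for Q
        proof -
          have sets_Q: "sets Q = sets P" using that M_ac by (auto simp: ac_probs_def)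
          interpret Q: prob_space Q using that M_ac by (auto simp: ac_probs_def)
          have "x \<in> borel_measurable Q" by (simp add: measurable_cong_sets[OF sets_Q refl])
          then show ?thesis
            by (rule Q.integrable_const_bound[of _ 1, rotated]) (auto simp: x_def indicator_def)
        qed
        then have "x \<in> E" by (auto simp: E_def E_space_def L1_def L0_def)
        moreover have "AE \<omega> in P. x \<omega> \<le> 0" by (simp add: x_def)
        ultimately have "x \<in> S" using S_eq wedge_L0_zero[OF assms(2)] by (auto intro!: bexI)
        have int: "integrable P (\<lambda>\<omega>. x \<omega> * W \<omega>)"
          using \<open>x \<in> E\<close> W_diff
          by (intro integrable_mult_density_diff[OF \<open>M \<noteq> {}\<close> M_ac mix]) (auto simp: E_def)
        have nn: "AE \<omega> in P. 0 \<le> x \<omega> * W \<omega>" by (auto simp: x_def indicator_def)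
        have "integral\<^sup>L P (\<lambda>\<omega>. x \<omega> * W \<omega>) = 0"
          using W_S[OF \<open>x \<in> S\<close>] integral_nonneg_AE[OF nn] by (simp add: bform_def)
        then have "AE \<omega> in P. x \<omega> * W \<omega> = 0"
          using integral_nonneg_eq_0_iff_AE[OF int nn] by simp
        with AE_space show ?thesis
          by eventually_elim (auto simp: x_def indicator_def split: if_splits)
      qed
      have "W \<in> density_cone M"
        using W_diff W_nonneg W_S \<open>K \<subseteq> S\<close>
        by (intro face_density_coneI[OF assms(4) \<open>M \<noteq> {}\<close>]) auto
      then obtain b Q where bQ: "0 \<le> b" "Q \<in> M" "AE \<omega> in P. W \<omega> = b * R P Q \<omega>"
        unfolding density_cone_def by auto
      have [measurable]: "z \<in> borel_measurable P" using \<open>z \<in> E\<close> by (rule E_meas)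
      \<comment> \<open>\<open>W\<close> is a nonnegative multiple of a density from
        \<open>M\<close>, so its pairing with the polar element \<open>z\<close> cannot be
        positive.\<close>
      have "bform P z W = (\<integral>\<omega>. b * (z \<omega> * R P Q \<omega>) \<partial>P)"
        unfolding bform_def using bQ(3)
        by (intro integral_cong_AE) (auto elim!: eventually_mono)
      also have "\<dots> = b * bform P z (R P Q)" by (simp add: bform_def)
      also have "\<dots> \<le> 0" using bQ z_le by (intro mult_nonneg_nonpos) auto
      finally show False using pos bform_W[OF \<open>z \<in> E\<close>] by simp
    qed
  qed
  then show ?thesis by (simp add: c_hull_def S_def E_def F_def)
qed

end
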